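(* Let $\mathfrak{O}$ be the valuation ring of a non-Archimedean local field of arbitrary characteristic, with residue field size $q$. Then: (i) $\displaystyle \mathsf{Z}_{\mathfrak{n}_d(\mathfrak{O})}(T) = \frac{(1-T)^{d-1}}{(1-qT)^d}$. (ii) $\displaystyle \mathsf{Z}_{\mathfrak{tr}_d(\mathfrak{O})}(T) = \mathsf{Z}_{\mathfrak{n}_{d+1}(\mathfrak{O})}(q^{-1}T) = \frac{(1-q^{-1}T)^d}{(1-T)^{d+1}}$.
   Context: $\mathfrak{tr}_d(\mathfrak{O})$ and $\mathfrak{n}_d(\mathfrak{O})$ are the $\mathfrak{O}$-submodules of $\mathrm{M}_d(\mathfrak{O})$ consisting of upper triangular and strictly upper triangular matrices, respectively ($d\ge 1$). Let $\mathfrak{P}$ be the maximal ideal of $\mathfrak{O}$ and $\mathfrak{O}_n=\mathfrak{O}/\mathfrak{P}^n$. For an $\mathfrak{O}$-submodule $M\subset\mathrm{M}_{d}(\mathfrak{O})$, let $M_n$ be its image in $\mathrm{M}_{d}(\mathfrak{O}_n)$ under entrywise reduction. The ask zeta function of $M$ is $\mathsf{Z}_M(T)=\sum_{n=0}^\infty \bigl(|M_n|^{-1}\sum_{a\in M_n}|\mathrm{Ker}(a)|\bigr)T^n$, where $\mathrm{Ker}(a)=\{x\in\mathfrak{O}_n^d: xa=0\}$ (row vectors). *)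

theory Defs
  imports
    "HOL-Algebra.Algebra"
    "HOL-Computational_Algebra.Formal_Power_Series"
begin

section \<open>Non-Archimedean local fields\<close>

text \<open>
  A non-Archimedean local field is a field that is complete with respect to a (normalised) discrete
  valuation and whose residue field is finite. No assumption is made on the characteristic.
  The valuation is encoded as an integer-valued function; its value at \<open>\<zero>\<close> is irrelevant, and the
  convention \<open>v \<zero> = \<infinity>\<close> appears as a disjunct \<open>x = \<zero>\<close> in inequalities \<open>v x \<ge> k\<close>.
\<close>

locale discretely_valued_field = field K for K (structure) +
  fixes v :: "'a \<Rightarrow> int"
  assumes v_mult:
      "\<lbrakk> x \<in> carrier K - {\<zero>}; y \<in> carrier K - {\<zero>} \<rbrakk> \<Longrightarrow> v (x \<otimes> y) = v x + v y"
    and v_add: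
      "\<lbrakk> x \<in> carrier K - {\<zero>}; y \<in> carrier K - {\<zero>}; x \<oplus> y \<noteq> \<zero> \<rbrakk>
        \<Longrightarrow> min (v x) (v y) \<le> v (x \<oplus> y)"
    and v_surj: "v ` (carrier K - {\<zero>}) = UNIV"

definition valuation_ring :: "('a, 'b) ring_scheme \<Rightarrow> ('a \<Rightarrow> int) \<Rightarrow> ('a, 'b) ring_scheme" where
  "valuation_ring K v = K\<lparr>carrier := {x \<in> carrier K. x = \<zero>\<^bsub>K\<^esub> \<or> 0 \<le> v x}\<rparr>"

definition valuation_ideal :: "('a, 'b) ring_scheme \<Rightarrow> ('a \<Rightarrow> int) \<Rightarrow> 'a set" where
  "valuation_ideal K v = {x \<in> carrier K. x = \<zero>\<^bsub>K\<^esub> \<or> 0 < v x}"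

definition residue_field :: "('a, 'b) ring_scheme \<Rightarrow> ('a \<Rightarrow> int) \<Rightarrow> 'a set ring" where
  "residue_field K v = valuation_ring K v Quot valuation_ideal K v"

locale nonarch_local_field = discretely_valued_field K v for K (structure) and v +
  assumes complete:
      "\<And>s :: nat \<Rightarrow> 'a.
        \<lbrakk> \<And>n. s n \<in> carrier K;
          \<And>k :: int. \<exists>n0. \<forall>m\<ge>n0. \<forall>n\<ge>n0. s m = s n \<or> k \<le> v (s m \<ominus> s n) \<rbrakk>
        \<Longrightarrow> \<exists>l\<in>carrier K. \<forall>k :: int. \<exists>n0. \<forall>n\<ge>n0. s n = l \<or> k \<le> v (s n \<ominus> l)"
    and finite_residue_field: "finite (carrier (residue_field K v))"


section \<open>Matrices and kernels\<close>

text \<open>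
  The \<open>d \<times> d\<close> matrices over a ring are the extensional functions on pairs of indices \<open>i, j < d\<close>,
  and row vectors of length \<open>d\<close> the extensional functions on indices \<open>i < d\<close>, so that cardinalities
  are the intended ones.
\<close>

definition mats :: "('a, 'b) ring_scheme \<Rightarrow> nat \<Rightarrow> (nat \<times> nat \<Rightarrow> 'a) set" where
  "mats R d = ({..<d} \<times> {..<d}) \<rightarrow>\<^sub>E carrier R"

definition row_vecs :: "('a, 'b) ring_scheme \<Rightarrow> nat \<Rightarrow> (nat \<Rightarrow> 'a) set" where
  "row_vecs R d = {..<d} \<rightarrow>\<^sub>E carrier R"

definition row_vec_mult ::
    "('a, 'b) ring_scheme \<Rightarrow> nat \<Rightarrow> (nat \<Rightarrow> 'a) \<Rightarrow> (nat \<times> nat \<Rightarrow> 'a) \<Rightarrow> (nat \<Rightarrow> 'a)" where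
  "row_vec_mult R d x a =
    (\<lambda>j\<in>{..<d}. \<Oplus>\<^bsub>R\<^esub>i\<in>{..<d}. x i \<otimes>\<^bsub>R\<^esub> a (i, j))"

definition mat_ker :: "('a, 'b) ring_scheme \<Rightarrow> nat \<Rightarrow> (nat \<times> nat \<Rightarrow> 'a) \<Rightarrow> (nat \<Rightarrow> 'a) set" where
  "mat_ker R d a = {x \<in> row_vecs R d. row_vec_mult R d x a = (\<lambda>j\<in>{..<d}. \<zero>\<^bsub>R\<^esub>)}"

definition upper_tri_mats :: "('a, 'b) ring_scheme \<Rightarrow> nat \<Rightarrow> (nat \<times> nat \<Rightarrow> 'a) set" where
  "upper_tri_mats R d = {a \<in> mats R d. \<forall>i<d. \<forall>j<d. j < i \<longrightarrow> a (i, j) = \<zero>\<^bsub>R\<^esub>}"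

definition strict_upper_tri_mats :: "('a, 'b) ring_scheme \<Rightarrow> nat \<Rightarrow> (nat \<times> nat \<Rightarrow> 'a) set" where
  "strict_upper_tri_mats R d = {a \<in> mats R d. \<forall>i<d. \<forall>j<d. j \<le> i \<longrightarrow> a (i, j) = \<zero>\<^bsub>R\<^esub>}"


section \<open>Ask zeta functions\<close>

text \<open>
  Here \<open>R\<close> is the ring, \<open>P\<close> its maximal ideal, and \<open>M\<close> a submodule of \<open>mats R d\<close>. Powers of \<open>P\<close> are
  taken in the multiplicative monoid of ideals; in particular \<open>P\<^sup>0 = carrier R\<close>, so that the quotient
  of level \<open>0\<close> is the zero ring.
\<close>

definition ideal_power :: "('a, 'b) ring_scheme \<Rightarrow> 'a set \<Rightarrow> nat \<Rightarrow> 'a set" where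
  "ideal_power R P n = P [^]\<^bsub>ideals_set R\<^esub> n"

definition quot_level :: "('a, 'b) ring_scheme \<Rightarrow> 'a set \<Rightarrow> nat \<Rightarrow> 'a set ring" where
  "quot_level R P n = R Quot (ideal_power R P n)"

definition reduce_mat ::
    "('a, 'b) ring_scheme \<Rightarrow> 'a set \<Rightarrow> nat \<Rightarrow> nat \<Rightarrow> (nat \<times> nat \<Rightarrow> 'a) \<Rightarrow> (nat \<times> nat \<Rightarrow> 'a set)" where
  "reduce_mat R P d n a =
    (\<lambda>ij\<in>{..<d} \<times> {..<d}. ideal_power R P n +>\<^bsub>R\<^esub> a ij)"

definition ask_average ::
    "('a, 'b) ring_scheme \<Rightarrow> 'a set \<Rightarrow> nat \<Rightarrow> (nat \<times> nat \<Rightarrow> 'a) set \<Rightarrow> nat \<Rightarrow> rat" where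
  "ask_average R P d M n =
    (let M_n = reduce_mat R P d n ` M
     in (\<Sum>a\<in>M_n. of_nat (card (mat_ker (quot_level R P n) d a))) / of_nat (card M_n))"

definition ask_zeta ::
    "('a, 'b) ring_scheme \<Rightarrow> 'a set \<Rightarrow> nat \<Rightarrow> (nat \<times> nat \<Rightarrow> 'a) set \<Rightarrow> rat fps" where
  "ask_zeta R P d M = Abs_fps (ask_average R P d M)"

end

theory Submission
  imports Defs
begin

text \<open>
  Let \<open>S = R / P\<^sup>n\<close>. Instead of averaging kernel sizes over matrices one counts the pairs \<open>(x, a)\<close>
  with \<open>xa = 0\<close> by their vector \<open>x\<close>. For a fixed vector \<open>x\<close> and \<open>a\<close> ranging over the upper
  triangular matrices, the map \<open>a \<mapsto> xa\<close> is additive, and its image is the product over all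
  columns \<open>j\<close> of the ideals \<open>(x\<^sub>0, \<dots>, x\<^sub>j)\<close>. Hence the average equals
  \<open>\<Sum>x. \<Prod>j. 1 / |(x\<^sub>0, \<dots>, x\<^sub>j)|\<close> (\<open>average_kernel_size\<close>). For strictly upper triangular
  matrices, the ideal in column \<open>j\<close> is \<open>(x\<^sub>0, \<dots>, x\<^sub>j\<^sub>-\<^sub>1)\<close> instead, so that the last coordinate is free
  and contributes a factor \<open>|S| = q\<^sup>n\<close>; this is the reason for the relation between
  the two zeta functions.

  The ring \<open>S\<close> is a finite chain ring: its ideals are \<open>I 0 \<supseteq> \<dots> \<supseteq> I n\<close> with \<open>|I m| = q\<^sup>n\<^sup>-\<^sup>m\<close>. The
  sum over \<open>x\<close> is therefore a walk: the ideal generated by the first entries is some \<open>I m\<close>, starting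
  from \<open>m = n\<close> for no entries, and a further entry leaves \<open>m\<close> fixed with total weight \<open>1\<close> or
  lowers it to a given \<open>k < m\<close> with total weight \<open>1 - 1/q\<close> (\<open>sum_next_coordinate\<close>). These
  weights do not depend on \<open>n\<close>. So one step of the walk is a fixed operator on functions of the
  level, and it acts on generating functions as multiplication by \<open>(1 - T/q) / (1 - T)\<close>
  (\<open>fps_transfer\<close>). Starting from \<open>1 / (1 - T)\<close>, the generating function of the constant \<open>1\<close>,
  \<open>d\<close> steps give the formula for upper triangular matrices; \<open>d - 1\<close> steps and the
  substitution of \<open>qT\<close> for \<open>T\<close> give the one for strictly upper triangular matrices.
\<close>

section \<open>The transfer operator on power series\<close>

text \<open>
  For a vector over a finite chain ring, a function \<open>\<phi>\<close> of the level of the ideal that its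
  entries generate, and a vector of level \<open>m\<close>, this is the weighted sum of \<open>\<phi>\<close> over all ways to
  append one more entry: the level stays \<open>m\<close> with total weight \<open>1\<close> and drops to each \<open>k < m\<close> with
  total weight \<open>1 - 1/q\<close> (see \<open>sum_next_coordinate\<close> below).
\<close>

definition transfer :: "rat \<Rightarrow> (nat \<Rightarrow> rat) \<Rightarrow> (nat \<Rightarrow> rat)" where
  "transfer q \<phi> m = \<phi> m + (1 - inverse q) * (\<Sum>k<m. \<phi> k)"

text \<open>
  On generating functions, \<open>\<phi> \<mapsto> (\<Sum>k<m. \<phi> k)\<close> is multiplication by \<open>T / (1 - T)\<close>, so the transfer
  operator multiplies by \<open>1 + (1 - 1/q) T / (1 - T) = (1 - T/q) / (1 - T)\<close>.
\<close>

lemma fps_transfer: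
  "Abs_fps (transfer q \<phi>) * (1 - fps_X) = Abs_fps \<phi> * (1 - fps_const (inverse q) * fps_X)"
proof (rule fps_ext)
  fix m
  show "fps_nth (Abs_fps (transfer q \<phi>) * (1 - fps_X)) m =
        fps_nth (Abs_fps \<phi> * (1 - fps_const (inverse q) * fps_X)) m"
    by (cases m)
       (simp_all add: transfer_def right_diff_distrib mult.left_commute[of _ "fps_const _"]
         add_divide_distrib distrib_left left_diff_distrib)
qed

lemma fps_transfer_iterate:
  "Abs_fps ((transfer q ^^ e) (\<lambda>_. 1)) =
     (1 - fps_const (inverse q) * fps_X) ^ e / (1 - fps_X) ^ (e + 1)"
proof -
  have "Abs_fps ((transfer q ^^ e) (\<lambda>_. 1)) * (1 - fps_X) ^ (e + 1) =
          (1 - fps_const (inverse q) * fps_X) ^ e"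
  proof (induction e)
    case 0
    have "Abs_fps (\<lambda>_. 1 :: rat) * (1 - fps_X) = 1"
    proof (rule fps_ext)
      fix m show "fps_nth (Abs_fps (\<lambda>_. 1 :: rat) * (1 - fps_X)) m = fps_nth 1 m"
        by (cases m) (simp_all add: algebra_simps)
    qed
    then show ?case by simp
  next
    case (Suc e)
    have "Abs_fps ((transfer q ^^ Suc e) (\<lambda>_. 1)) * (1 - fps_X) ^ (Suc e + 1) =
        (Abs_fps (transfer q ((transfer q ^^ e) (\<lambda>_. 1))) * (1 - fps_X)) * (1 - fps_X) ^ (e + 1)"
      by (simp add: mult_ac)
    also have "\<dots> = (Abs_fps ((transfer q ^^ e) (\<lambda>_. 1)) * (1 - fps_X) ^ (e + 1)) *
        (1 - fps_const (inverse q) * fps_X)"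
      unfolding fps_transfer by (simp only: mult_ac)
    also have "\<dots> = (1 - fps_const (inverse q) * fps_X) ^ Suc e"
      by (simp only: Suc.IH power_Suc2)
    finally show ?case .
  qed
  moreover have "(1 - fps_X :: rat fps) ^ (e + 1) \<noteq> 0"
  proof -
    have "fps_nth (1 - fps_X :: rat fps) 0 \<noteq> 0" by simp
    then have "1 - fps_X \<noteq> (0 :: rat fps)" by (metis fps_zero_nth)
    then show ?thesis by simp
  qed
  ultimately show ?thesis by (metis fps_divide_times_eq)
qed

section \<open>Finite chain rings\<close>

text \<open>
  Splitting off the last coordinate, so that sums over vectors can be evaluated by induction on
  their length.
\<close>

lemma sum_PiE_lessThan_Suc:
  fixes F :: "(nat \<Rightarrow> 'a) \<Rightarrow> 'b :: comm_monoid_add"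
  shows "(\<Sum>x\<in>{..<Suc e} \<rightarrow>\<^sub>E A. F x) = (\<Sum>g\<in>{..<e} \<rightarrow>\<^sub>E A. \<Sum>t\<in>A. F (g(e := t)))"
proof -
  have "(\<Sum>x\<in>{..<Suc e} \<rightarrow>\<^sub>E A. F x) = (\<Sum>(t, g)\<in>A \<times> ({..<e} \<rightarrow>\<^sub>E A). F (g(e := t)))"
    unfolding lessThan_Suc PiE_insert_eq
    by (subst sum.reindex[OF inj_combinator]) (auto intro!: sum.cong)
  also have "\<dots> = (\<Sum>t\<in>A. \<Sum>g\<in>{..<e} \<rightarrow>\<^sub>E A. F (g(e := t)))"
    by (simp add: sum.cartesian_product)
  also have "\<dots> = (\<Sum>g\<in>{..<e} \<rightarrow>\<^sub>E A. \<Sum>t\<in>A. F (g(e := t)))"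
    by (rule sum.swap)
  finally show ?thesis .
qed

text \<open>
  In column \<open>j\<close> only the first \<open>c j\<close> entries may be nonzero. The choices \<open>c = Suc\<close> and \<open>c = id\<close> give
  the upper triangular and the strictly upper triangular matrices, so both are treated at once.
\<close>

definition staircase ::
    "('a, 'b) ring_scheme \<Rightarrow> (nat \<Rightarrow> nat) \<Rightarrow> nat \<Rightarrow> (nat \<times> nat \<Rightarrow> 'a) set" where
  "staircase R c d = {a \<in> mats R d. \<forall>i<d. \<forall>j<d. c j \<le> i \<longrightarrow> a (i, j) = \<zero>\<^bsub>R\<^esub>}"

lemma upper_tri_mats_eq_staircase: "upper_tri_mats R d = staircase R Suc d"
  by (simp add: upper_tri_mats_def staircase_def Suc_le_eq)

lemma strict_upper_tri_mats_eq_staircase: "strict_upper_tri_mats R d = staircase R id d"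
  by (simp add: strict_upper_tri_mats_def staircase_def)

text \<open>
  The quotients \<open>R / P\<^sup>n\<close> of a discrete valuation ring enter the count only through the following
  data: a descending chain of ideals \<open>I 0 \<supseteq> \<dots> \<supseteq> I n\<close>, in which each step has index \<open>q\<close> and
  which contains every principal ideal.
\<close>

locale finite_chain_ring = cring S for S (structure) +
  fixes I :: "nat \<Rightarrow> 'a set" and n q :: nat
  assumes layer_ideal: "m \<le> n \<Longrightarrow> ideal (I m) S"
    and layer_0: "I 0 = carrier S"
    and layer_decreasing: "m < n \<Longrightarrow> I (Suc m) \<subseteq> I m"
    and card_layer: "m \<le> n \<Longrightarrow> card (I m) = q ^ (n - m)"
    and q_gt_1: "1 < q"
    and principal: "x \<in> carrier S \<Longrightarrow> \<exists>m\<le>n. (\<lambda>y. x \<otimes> y) ` carrier S = I m"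
begin

lemma layer_antimono:
  assumes "k \<le> m" "m \<le> n"
  shows "I m \<subseteq> I k"
  using assms
proof (induction rule: dec_induct)
  case (step m)
  then show ?case using layer_decreasing[of m] by (meson Suc_leD Suc_le_eq order_trans)
qed simp

lemma finite_layer: "m \<le> n \<Longrightarrow> finite (I m)"
  using card_layer[of m] q_gt_1 by (intro card_ge_0_finite) simp

lemma finite_carrier: "finite (carrier S)"
  using finite_layer[of 0] layer_0 by simp

lemma card_layer_pos: "m \<le> n \<Longrightarrow> card (I m) > 0"
  using card_layer q_gt_1 by simp

text \<open>
  The valuation of \<open>x\<close>, truncated at \<open>n\<close>.
\<close>

definition level :: "'a \<Rightarrow> nat" where
  "level x = (SOME m. m \<le> n \<and> (\<lambda>y. x \<otimes> y) ` carrier S = I m)"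

lemma level:
  assumes "x \<in> carrier S"
  shows "level x \<le> n" and "(\<lambda>y. x \<otimes> y) ` carrier S = I (level x)"
proof -
  have "level x \<le> n \<and> (\<lambda>y. x \<otimes> y) ` carrier S = I (level x)"
    unfolding level_def using principal[OF assms] by (rule someI_ex)
  then show "level x \<le> n" "(\<lambda>y. x \<otimes> y) ` carrier S = I (level x)" by auto
qed

text \<open>
  As \<open>x\<close> generates \<open>I (level x)\<close>, membership in \<open>I m\<close> is the containment of one ideal of the chain
  in another, which their sizes decide.
\<close>

lemma in_layer_iff:
  assumes "x \<in> carrier S" "m \<le> n"
  shows "x \<in> I m \<longleftrightarrow> m \<le> level x"
proof
  assume "x \<in> I m"
  then have "I (level x) \<subseteq> I m"
    unfolding level(2)[OF assms(1), symmetric]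
    using ideal.I_r_closed[OF layer_ideal[OF assms(2)]] by auto
  then have "q ^ (n - level x) \<le> q ^ (n - m)"
    unfolding card_layer[OF level(1)[OF assms(1)], symmetric] card_layer[OF assms(2), symmetric]
    by (rule card_mono[OF finite_layer[OF assms(2)]])
  then have "n - level x \<le> n - m"
    using power_le_imp_le_exp[OF q_gt_1] by blast
  then show "m \<le> level x"
    using assms(2) by linarith
next
  assume "m \<le> level x"
  moreover have "x \<in> I (level x)"
    unfolding level(2)[OF assms(1), symmetric]
    using assms(1) by (intro image_eqI[where x = \<one>]) auto
  ultimately show "x \<in> I m"
    using layer_antimono[OF _ level(1)[OF assms(1)], of m] by auto
qed

text \<open>
  By \<open>linear_form_image\<close> below, \<open>I (min_level x k)\<close> is the ideal generated by
  \<open>x 0, \<dots>, x (k - 1)\<close>; the value \<open>n\<close> at \<open>k = 0\<close> stands for the zero ideal \<open>I n\<close>.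
\<close>

primrec min_level :: "(nat \<Rightarrow> 'a) \<Rightarrow> nat \<Rightarrow> nat" where
  "min_level x 0 = n"
| "min_level x (Suc k) = min (min_level x k) (level (x k))"

lemma min_level_le: "min_level x k \<le> n"
  by (induction k) auto

lemma min_level_cong: "(\<And>i. i < k \<Longrightarrow> x i = y i) \<Longrightarrow> min_level x k = min_level y k"
  by (induction k) auto

lemma sum_layers:
  assumes "a \<le> n" "b \<le> n"
  shows "(\<lambda>(y, z). y \<oplus> z) ` (I a \<times> I b) = I (min a b)"
proof
  interpret A: ideal "I (min a b)" S using assms layer_ideal by simp
  show "(\<lambda>(y, z). y \<oplus> z) ` (I a \<times> I b) \<subseteq> I (min a b)"
    using layer_antimono[of "min a b" a] layer_antimono[of "min a b" b] assms A.a_closed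
    by fastforce
  interpret B: ideal "I a" S using assms layer_ideal by simp
  interpret C: ideal "I b" S using assms layer_ideal by simp
  show "I (min a b) \<subseteq> (\<lambda>(y, z). y \<oplus> z) ` (I a \<times> I b)"
  proof
    fix z assume z: "z \<in> I (min a b)"
    then have "z \<in> carrier S" by (rule A.Icarr)
    then have "z = (\<lambda>(y, z). y \<oplus> z) (z, \<zero>)" "z = (\<lambda>(y, z). y \<oplus> z) (\<zero>, z)"
      by simp_all
    moreover have "(z, \<zero>) \<in> I a \<times> I b \<or> (\<zero>, z) \<in> I a \<times> I b"
      using z B.zero_closed C.zero_closed by (cases "a \<le> b") (simp_all add: min_def)
    ultimately show "z \<in> (\<lambda>(y, z). y \<oplus> z) ` (I a \<times> I b)"
      by blast
  qed
qed

text \<open>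
  A linear form takes exactly the values in the ideal generated by its coefficients, and since the
  ideals form a chain, this is the largest of the principal ideals involved.
\<close>

lemma linear_form_image:
  assumes "x \<in> {..<k} \<rightarrow> carrier S"
  shows "(\<lambda>y. \<Oplus>i\<in>{..<k}. x i \<otimes> y i) ` ({..<k} \<rightarrow>\<^sub>E carrier S) = I (min_level x k)"
  using assms
proof (induction k)
  case 0
  interpret N: ideal "I n" S using layer_ideal by simp
  have "card (I n) = 1" using card_layer[of n] by simp
  then obtain z where "I n = {z}" by (rule card_1_singletonE)
  then have "I n = {\<zero>}" using N.zero_closed by simp
  then show ?case by simp
next
  case (Suc k)
  then have xk: "x k \<in> carrier S" and x: "x \<in> {..<k} \<rightarrow> carrier S" by auto
  have sum_Suc: "(\<Oplus>i\<in>{..<Suc k}. x i \<otimes> (g(k := t)) i) = x k \<otimes> t \<oplus> (\<Oplus>i\<in>{..<k}. x i \<otimes> g i)"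
    if "t \<in> carrier S" "g \<in> {..<k} \<rightarrow>\<^sub>E carrier S" for t g
  proof -
    have "(\<Oplus>i\<in>{..<Suc k}. x i \<otimes> (g(k := t)) i) =
        x k \<otimes> t \<oplus> (\<Oplus>i\<in>{..<k}. x i \<otimes> (g(k := t)) i)"
      unfolding lessThan_Suc using that x xk
      by (subst finsum_insert) (auto simp: Pi_iff PiE_iff)
    also have "(\<Oplus>i\<in>{..<k}. x i \<otimes> (g(k := t)) i) = (\<Oplus>i\<in>{..<k}. x i \<otimes> g i)"
      using that x by (intro finsum_cong') (auto simp: Pi_iff PiE_iff)
    finally show ?thesis .
  qed
  have "(\<lambda>y. \<Oplus>i\<in>{..<Suc k}. x i \<otimes> y i) ` ({..<Suc k} \<rightarrow>\<^sub>E carrier S) =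
      (\<lambda>(t, g). x k \<otimes> t \<oplus> (\<Oplus>i\<in>{..<k}. x i \<otimes> g i)) ` (carrier S \<times> ({..<k} \<rightarrow>\<^sub>E carrier S))"
    unfolding lessThan_Suc PiE_insert_eq image_image
    by (rule image_cong[OF refl]) (use sum_Suc lessThan_Suc in auto)
  also have "\<dots> = (\<lambda>(y, z). y \<oplus> z) ` ((\<lambda>t. x k \<otimes> t) ` carrier S \<times>
      (\<lambda>g. \<Oplus>i\<in>{..<k}. x i \<otimes> g i) ` ({..<k} \<rightarrow>\<^sub>E carrier S))"
    by force
  also have "\<dots> = I (min (level (x k)) (min_level x k))"
    using Suc.IH[OF x] level[OF xk] min_level_le sum_layers by simp
  finally show ?case by (simp add: min.commute)
qed

subsection \<open>Staircase matrices\<close>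

lemma finite_staircase: "finite (staircase S c d)"
  unfolding staircase_def mats_def
  by (rule finite_subset[of _ "({..<d} \<times> {..<d}) \<rightarrow>\<^sub>E carrier S"])
     (auto intro!: finite_PiE finite_carrier)

lemma row_vec_mult_staircase:
  assumes "x \<in> row_vecs S d" "a \<in> staircase S c d" "j < d" "c j \<le> d"
  shows "row_vec_mult S d x a j = (\<Oplus>i\<in>{..<c j}. x i \<otimes> a (i, j))"
proof -
  have "(\<Oplus>i\<in>{..<d}. x i \<otimes> a (i, j)) = (\<Oplus>i\<in>{..<c j}. x i \<otimes> a (i, j))"
    using assms
    by (intro add.finprod_mono_neutral_cong_right)
       (auto simp: staircase_def mats_def row_vecs_def PiE_iff Pi_iff)
  then show ?thesis using assms(3) by (simp add: row_vec_mult_def)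
qed

text \<open>
  For fixed \<open>x\<close>, the columns of a staircase matrix \<open>a\<close> can be chosen independently, and the
  \<open>j\<close>-th entry of \<open>xa\<close> is an arbitrary value of the linear form with coefficients
  \<open>x 0, \<dots>, x (c j - 1)\<close>.
\<close>

lemma row_vec_mult_image:
  assumes x: "x \<in> row_vecs S d" and c: "\<And>j. j < d \<Longrightarrow> c j \<le> d"
  shows "row_vec_mult S d x ` staircase S c d = (\<Pi>\<^sub>E j\<in>{..<d}. I (min_level x (c j)))"
proof
  have xc: "x \<in> {..<c j} \<rightarrow> carrier S" if "j < d" for j
  proof
    fix i assume "i \<in> {..<c j}"
    then have "i \<in> {..<d}" using c[OF that] by simp
    with x show "x i \<in> carrier S" unfolding row_vecs_def by (rule PiE_mem)
  qed
  show "row_vec_mult S d x ` staircase S c d \<subseteq> (\<Pi>\<^sub>E j\<in>{..<d}. I (min_level x (c j)))"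
  proof (intro image_subsetI PiE_I)
    fix a j assume a: "a \<in> staircase S c d" and "j \<in> {..<d}"
    then have j: "j < d" by simp
    have "restrict (\<lambda>i. a (i, j)) {..<c j} \<in> {..<c j} \<rightarrow>\<^sub>E carrier S"
      using a j c[OF j] by (auto simp: staircase_def mats_def PiE_iff)
    moreover have "(\<Oplus>i\<in>{..<c j}. x i \<otimes> a (i, j)) =
        (\<Oplus>i\<in>{..<c j}. x i \<otimes> restrict (\<lambda>i. a (i, j)) {..<c j} i)"
      using a j c[OF j] xc[OF j]
      by (intro finsum_cong') (auto simp: staircase_def mats_def PiE_iff Pi_iff)
    ultimately show "row_vec_mult S d x a j \<in> I (min_level x (c j))"
      unfolding row_vec_mult_staircase[OF x a j c[OF j]] linear_form_image[OF xc[OF j], symmetric]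
      by blast
  qed (simp add: row_vec_mult_def)
  show "(\<Pi>\<^sub>E j\<in>{..<d}. I (min_level x (c j))) \<subseteq> row_vec_mult S d x ` staircase S c d"
  proof
    fix z assume z: "z \<in> (\<Pi>\<^sub>E j\<in>{..<d}. I (min_level x (c j)))"
    have "\<exists>y. y \<in> {..<c j} \<rightarrow>\<^sub>E carrier S \<and> z j = (\<Oplus>i\<in>{..<c j}. x i \<otimes> y i)" if "j < d" for j
    proof -
      have "z j \<in> I (min_level x (c j))" using z that by auto
      then show ?thesis unfolding linear_form_image[OF xc[OF that], symmetric] by blast
    qed
    then obtain y where y: "\<And>j. j < d \<Longrightarrow> y j \<in> {..<c j} \<rightarrow>\<^sub>E carrier S"
      "\<And>j. j < d \<Longrightarrow> z j = (\<Oplus>i\<in>{..<c j}. x i \<otimes> y j i)" by metis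
    define a where "a = (\<lambda>(i, j)\<in>{..<d} \<times> {..<d}. if i < c j then y j i else \<zero>)"
    have a: "a \<in> staircase S c d"
      using y(1) by (auto simp: a_def staircase_def mats_def PiE_iff)
    have "row_vec_mult S d x a j = z j" for j
    proof (cases "j < d")
      case True
      have "(\<Oplus>i\<in>{..<c j}. x i \<otimes> a (i, j)) = (\<Oplus>i\<in>{..<c j}. x i \<otimes> y j i)"
        using y(1)[OF True] xc[OF True] True c[OF True]
        by (intro finsum_cong') (auto simp: a_def PiE_iff Pi_iff)
      then show ?thesis using row_vec_mult_staircase[OF x a True c[OF True]] y(2)[OF True] by simp
    next
      case False
      then show ?thesis using z by (auto simp: row_vec_mult_def PiE_iff extensional_def)
    qed
    then have "z = row_vec_mult S d x a" by (simp add: fun_eq_iff)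
    with a show "z \<in> row_vec_mult S d x ` staircase S c d" by blast
  qed
qed

text \<open>
  The map \<open>a \<mapsto> xa\<close> is additive, so its nonempty fibres are translates of its kernel; hence the
  number of staircase matrices is the size of the kernel times the size of the image, which is
  known from \<open>row_vec_mult_image\<close>.
\<close>

lemma card_annihilating_staircase:
  assumes x: "x \<in> row_vecs S d" and c: "\<And>j. j < d \<Longrightarrow> c j \<le> d"
  shows "card (staircase S c d) =
    card {a \<in> staircase S c d. row_vec_mult S d x a = (\<lambda>j\<in>{..<d}. \<zero>)} *
    (\<Prod>j<d. card (I (min_level x (c j))))"
proof -
  let ?M = "staircase S c d" and ?f = "row_vec_mult S d x"
  let ?K = "{a \<in> ?M. ?f a = (\<lambda>j\<in>{..<d}. \<zero>)}" and ?D = "{..<d} \<times> {..<d}"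
  have entry: "a p \<in> carrier S" if "a \<in> ?M" "p \<in> ?D" for a p
    using that by (auto simp: staircase_def mats_def)
  have ext: "a p = undefined" if "a \<in> ?M" "p \<notin> ?D" for a p
    using that unfolding staircase_def mats_def by (blast intro: PiE_arb)
  have xi: "x i \<in> carrier S" if "i < d" for i
    using that x by (auto simp: row_vecs_def)
  have f_add: "?f (\<lambda>p\<in>?D. a p \<oplus> b p) = (\<lambda>j\<in>{..<d}. ?f a j \<oplus> ?f b j)"
    if "a \<in> ?M" "b \<in> ?M" for a b
  proof -
    have "(\<Oplus>i\<in>{..<d}. x i \<otimes> (\<lambda>p\<in>?D. a p \<oplus> b p) (i, j)) =
        (\<Oplus>i\<in>{..<d}. x i \<otimes> a (i, j)) \<oplus> (\<Oplus>i\<in>{..<d}. x i \<otimes> b (i, j))" if "j < d" for j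
    proof -
      have "(\<Oplus>i\<in>{..<d}. x i \<otimes> (\<lambda>p\<in>?D. a p \<oplus> b p) (i, j)) =
          (\<Oplus>i\<in>{..<d}. x i \<otimes> a (i, j) \<oplus> x i \<otimes> b (i, j))"
        using \<open>a \<in> ?M\<close> \<open>b \<in> ?M\<close> that entry xi by (intro finsum_cong') (auto simp: r_distr)
      also have "\<dots> = (\<Oplus>i\<in>{..<d}. x i \<otimes> a (i, j)) \<oplus> (\<Oplus>i\<in>{..<d}. x i \<otimes> b (i, j))"
        using \<open>a \<in> ?M\<close> \<open>b \<in> ?M\<close> that entry xi by (intro finsum_addf) auto
      finally show ?thesis .
    qed
    then show ?thesis by (auto simp: row_vec_mult_def fun_eq_iff)
  qed
  have add_M: "(\<lambda>p\<in>?D. a p \<oplus> b p) \<in> ?M" if "a \<in> ?M" "b \<in> ?M" for a b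
    using that by (auto simp: staircase_def mats_def)
  have f_closed: "?f a j \<in> carrier S" if "a \<in> ?M" "j < d" for a j
    using that entry xi by (auto simp: row_vec_mult_def intro!: finsum_closed)
  have f_ext: "?f a j = undefined" if "\<not> j < d" for a j
    using that by (simp add: row_vec_mult_def)
  have fibre: "card {a \<in> ?M. ?f a = z} = card ?K" if "z \<in> ?f ` ?M" for z
  proof -
    obtain b where b: "b \<in> ?M" "?f b = z" using \<open>z \<in> ?f ` ?M\<close> by blast
    \<comment> \<open>Translation by a point \<open>b\<close> of the fibre and translation by \<open>-b\<close> are mutually inverse
      bijections between the kernel and the fibre.\<close>
    let ?t = "\<lambda>b a. \<lambda>p\<in>?D. a p \<oplus> b p"
    define b' where "b' = (\<lambda>p\<in>?D. \<ominus> b p)"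
    have b': "b' \<in> ?M" using b(1) by (auto simp: b'_def staircase_def mats_def)
    have cancel: "?t b (?t b' a) = a" "?t b' (?t b a) = a" if "a \<in> ?M" for a
      using that entry[OF b(1)] entry[OF that] ext[OF that]
      by (auto simp: fun_eq_iff b'_def a_assoc l_neg r_neg)
    have z0: "z j \<oplus> ?f b' j = \<zero>" if "j < d" for j
    proof -
      have zero: "?t b' b = (\<lambda>p\<in>?D. \<zero>)"
        using entry[OF b(1)] by (auto simp: fun_eq_iff b'_def r_neg)
      have "z j \<oplus> ?f b' j = ?f (?t b' b) j" using f_add[OF b(1) b'] b(2) that by simp
      also have "\<dots> = (\<Oplus>i\<in>{..<d}. x i \<otimes> (\<lambda>p\<in>?D. \<zero>) (i, j))"
        unfolding zero using that by (simp add: row_vec_mult_def)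
      also have "\<dots> = (\<Oplus>i\<in>{..<d}. \<zero>)"
        using that xi by (intro finsum_cong') auto
      finally show ?thesis by simp
    qed
    have "bij_betw (?t b) ?K {a \<in> ?M. ?f a = z}"
    proof (rule bij_betwI[where g = "?t b'"])
      show "?t b \<in> ?K \<rightarrow> {a \<in> ?M. ?f a = z}"
      proof
        fix a assume a: "a \<in> ?K"
        then have "?f (?t b a) j = z j" for j
          using f_add[OF _ b(1), of a] b f_closed[OF b(1), of j] f_ext[of j b] by (cases "j < d") auto
        then show "?t b a \<in> {a \<in> ?M. ?f a = z}" using a add_M b(1) by auto
      qed
      show "?t b' \<in> {a \<in> ?M. ?f a = z} \<rightarrow> ?K"
      proof
        fix a assume a: "a \<in> {a \<in> ?M. ?f a = z}"
        then have "?f (?t b' a) = (\<lambda>j\<in>{..<d}. \<zero>)"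
          using f_add[OF _ b', of a] z0 by (auto simp: fun_eq_iff)
        then show "?t b' a \<in> ?K" using a add_M b' by auto
      qed
    qed (use cancel in auto)
    then show ?thesis by (simp add: bij_betw_same_card)
  qed
  have "card ?M = (\<Sum>a\<in>?M. 1)" by simp
  also have "\<dots> = (\<Sum>z\<in>?f ` ?M. card {a \<in> ?M. ?f a = z})"
    by (subst sum.image_gen[OF finite_staircase, of _ _ _ ?f]) simp
  also have "\<dots> = card ?K * card (?f ` ?M)" using fibre by simp
  also have "card (?f ` ?M) = (\<Prod>j<d. card (I (min_level x (c j))))"
    using row_vec_mult_image[OF x, of c] c by (simp add: card_PiE)
  finally show ?thesis .
qed

text \<open>
  Double counting of the pairs \<open>(x, a)\<close> with \<open>xa = 0\<close> turns the average over matrices into a sum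
  over vectors in which the matrices no longer occur.
\<close>

lemma average_kernel_size:
  assumes c: "\<And>j. j < d \<Longrightarrow> c j \<le> d"
  shows "(\<Sum>a\<in>staircase S c d. of_nat (card (mat_ker S d a))) / of_nat (card (staircase S c d)) =
    (\<Sum>x\<in>row_vecs S d. \<Prod>j<d. inverse (of_nat (card (I (min_level x (c j)))) :: rat))"
proof -
  let ?M = "staircase S c d" and ?V = "row_vecs S d"
  let ?zero = "\<lambda>j\<in>{..<d}. \<zero>"
  have fV: "finite ?V" unfolding row_vecs_def by (auto intro!: finite_PiE finite_carrier)
  have "(\<lambda>p\<in>{..<d} \<times> {..<d}. \<zero>) \<in> ?M" by (auto simp: staircase_def mats_def)
  then have M_pos: "card ?M > 0" using finite_staircase card_gt_0_iff by blast
  have "(\<Sum>a\<in>?M. of_nat (card (mat_ker S d a)) :: rat) =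
      (\<Sum>a\<in>?M. \<Sum>x\<in>?V. if row_vec_mult S d x a = ?zero then 1 else 0)"
    using fV by (simp add: mat_ker_def sum.If_cases Int_def)
  also have "\<dots> = (\<Sum>x\<in>?V. of_nat (card {a \<in> ?M. row_vec_mult S d x a = ?zero}))"
    by (subst sum.swap) (simp add: sum.If_cases Int_def finite_staircase)
  finally have "(\<Sum>a\<in>?M. of_nat (card (mat_ker S d a)) :: rat) / of_nat (card ?M) =
      (\<Sum>x\<in>?V. of_nat (card {a \<in> ?M. row_vec_mult S d x a = ?zero}) / of_nat (card ?M))"
    by (simp add: sum_divide_distrib)
  also have "\<dots> = (\<Sum>x\<in>?V. \<Prod>j<d. inverse (of_nat (card (I (min_level x (c j))))))"
  proof (rule sum.cong[OF refl])
    fix x assume "x \<in> ?V"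
    define p where "p = (\<Prod>j<d. card (I (min_level x (c j))))"
    have "card ?M = card {a \<in> ?M. row_vec_mult S d x a = ?zero} * p"
      unfolding p_def using \<open>x \<in> ?V\<close> c by (rule card_annihilating_staircase)
    moreover have "(\<Prod>j<d. inverse (of_nat (card (I (min_level x (c j)))) :: rat)) = inverse (of_nat p)"
      by (simp add: p_def prod_inversef[unfolded o_def])
    ultimately show "of_nat (card {a \<in> ?M. row_vec_mult S d x a = ?zero}) / of_nat (card ?M) =
        (\<Prod>j<d. inverse (of_nat (card (I (min_level x (c j)))) :: rat))"
      using M_pos by (simp add: divide_simps)
  qed
  finally show ?thesis .
qed

subsection \<open>Summing over vectors\<close>

text \<open>
  Exactly \<open>|I k| - |I (k + 1)| = |I k| (1 - 1/q)\<close> elements have level \<open>k\<close>, so after division by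
  \<open>|I k|\<close> each level \<open>k < m\<close> contributes with the same weight, independent of \<open>k\<close> and \<open>n\<close>.
\<close>

lemma sum_outside_layer:
  fixes g :: "nat \<Rightarrow> rat"
  assumes "m \<le> n"
  shows "(\<Sum>t\<in>carrier S - I m. inverse (of_nat (card (I (level t)))) * g (level t)) =
    (1 - inverse (of_nat q)) * (\<Sum>k<m. g k)"
  using assms
proof (induction m)
  case 0
  then show ?case by (simp add: layer_0)
next
  case (Suc m)
  let ?h = "\<lambda>t. inverse (of_nat (card (I (level t)))) * g (level t)"
  have sub: "I (Suc m) \<subseteq> I m" "I m \<subseteq> carrier S"
    using Suc.prems layer_decreasing layer_antimono[of 0 m] layer_0 by auto
  have fin: "finite (I m)" "finite (I (Suc m))" using Suc.prems finite_layer by auto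
  have lev: "level t = m" if "t \<in> I m - I (Suc m)" for t
    using that sub in_layer_iff[of t m] in_layer_iff[of t "Suc m"] Suc.prems by auto
  have "carrier S - I (Suc m) = (carrier S - I m) \<union> (I m - I (Suc m))" using sub by blast
  then have "(\<Sum>t\<in>carrier S - I (Suc m). ?h t) = (\<Sum>t\<in>carrier S - I m. ?h t) + (\<Sum>t\<in>I m - I (Suc m). ?h t)"
    using finite_carrier fin by (simp add: sum.union_disjoint[symmetric] disjoint_iff)
  also have "(\<Sum>t\<in>I m - I (Suc m). ?h t) =
      of_nat (card (I m) - card (I (Suc m))) * (inverse (of_nat (card (I m))) * g m)"
    using lev sub fin by (simp add: card_Diff_subset)
  also have "of_nat (card (I m) - card (I (Suc m))) * (inverse (of_nat (card (I m))) * g m) =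
      (1 - inverse (of_nat q)) * g m"
  proof -
    have "card (I m) = q * card (I (Suc m))"
      using card_layer[of m] card_layer[of "Suc m"] Suc.prems
      by (simp add: Suc_diff_Suc flip: power_Suc)
    then show ?thesis
      using card_layer_pos[of "Suc m"] q_gt_1 Suc.prems
      by (simp add: field_simps)
  qed
  finally show ?case using Suc by (simp add: algebra_simps)
qed

text \<open>
  An entry \<open>t\<close> appended to a vector of level \<open>m\<close> keeps the level if \<open>t \<in> I m\<close>, and otherwise lowers
  it to the level of \<open>t\<close>. The weight \<open>1 / |I|\<close> makes the result depend on \<open>q\<close> but not on \<open>n\<close>.
\<close>

lemma sum_next_coordinate:
  fixes \<phi> :: "nat \<Rightarrow> rat"
  assumes m: "m \<le> n"
  shows "(\<Sum>t\<in>carrier S. inverse (of_nat (card (I (min m (level t))))) * \<phi> (min m (level t))) =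
    transfer (of_nat q) \<phi> m"
proof -
  let ?h = "\<lambda>t. inverse (of_nat (card (I (min m (level t))))) * \<phi> (min m (level t))"
  have sub: "I m \<subseteq> carrier S" using m layer_antimono[of 0 m] layer_0 by auto
  have "(\<Sum>t\<in>carrier S. ?h t) = (\<Sum>t\<in>carrier S - I m. ?h t) + (\<Sum>t\<in>I m. ?h t)"
    using sub finite_carrier by (rule sum.subset_diff)
  also have "(\<Sum>t\<in>I m. ?h t) = (\<Sum>t\<in>I m. inverse (of_nat (card (I m))) * \<phi> m)"
    using in_layer_iff[OF _ m] sub by (intro sum.cong refl) (auto simp: min_def)
  also have "\<dots> = \<phi> m" using card_layer_pos[OF m] by simp
  also have "(\<Sum>t\<in>carrier S - I m. ?h t) =
      (\<Sum>t\<in>carrier S - I m. inverse (of_nat (card (I (level t)))) * \<phi> (level t))"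
    using in_layer_iff[OF _ m] by (intro sum.cong refl) (auto simp: min_def)
  finally show ?thesis using sum_outside_layer[OF m] by (simp add: transfer_def)
qed

text \<open>
  Induction on the length of the vectors must let \<open>\<phi>\<close> vary: removing the last entry replaces \<open>\<phi>\<close> by
  its transfer. For the empty vector the level is \<open>n\<close>, whence the evaluation at \<open>n\<close>.
\<close>

lemma sum_row_vecs:
  fixes \<phi> :: "nat \<Rightarrow> rat"
  shows "(\<Sum>x\<in>row_vecs S e. (\<Prod>j<e. inverse (of_nat (card (I (min_level x (Suc j)))))) *
      \<phi> (min_level x e)) = (transfer (of_nat q) ^^ e) \<phi> n"
proof (induction e arbitrary: \<phi>)
  case 0
  then show ?case by (simp add: row_vecs_def)
next
  case (Suc e)
  let ?w = "\<lambda>k. inverse (of_nat (card (I k)) :: rat)"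
  have upd: "min_level (g(e := t)) j = min_level g j" if "j \<le> e" for g t j
    using that by (intro min_level_cong) auto
  have "(\<Sum>x\<in>row_vecs S (Suc e). (\<Prod>j<Suc e. ?w (min_level x (Suc j))) * \<phi> (min_level x (Suc e))) =
      (\<Sum>g\<in>row_vecs S e. \<Sum>t\<in>carrier S. (\<Prod>j<e. ?w (min_level g (Suc j))) *
        (?w (min (min_level g e) (level t)) * \<phi> (min (min_level g e) (level t))))"
    unfolding row_vecs_def sum_PiE_lessThan_Suc
    by (intro sum.cong refl) (simp add: upd mult.assoc del: min_level.simps, simp add: upd)
  also have "\<dots> = (\<Sum>g\<in>row_vecs S e. (\<Prod>j<e. ?w (min_level g (Suc j))) *
      transfer (of_nat q) \<phi> (min_level g e))"
    by (simp only: sum_distrib_left[symmetric] sum_next_coordinate[OF min_level_le])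
  also have "\<dots> = (transfer (of_nat q) ^^ e) (transfer (of_nat q) \<phi>) n"
    by (rule Suc.IH)
  finally show ?case by (simp add: funpow_swap1)
qed

lemma average_kernel_triangular:
  "(\<Sum>a\<in>staircase S Suc d. of_nat (card (mat_ker S d a))) / of_nat (card (staircase S Suc d)) =
    (transfer (of_nat q) ^^ d) (\<lambda>_. 1) n"
  using average_kernel_size[of d Suc] sum_row_vecs[of d "\<lambda>_. 1"] by simp

text \<open>
  In the strictly triangular case column \<open>j\<close> involves the entries before \<open>x j\<close> only. Column \<open>0\<close>
  therefore has weight \<open>1 / |I n| = 1\<close>, and the last entry of \<open>x\<close> does not affect the weight, which
  yields the factor \<open>q\<^sup>n\<close>; what remains is the triangular count for vectors that are one entry
  shorter.
\<close>

lemma average_kernel_strictly_triangular: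
  "(\<Sum>a\<in>staircase S id (Suc e). of_nat (card (mat_ker S (Suc e) a))) / of_nat (card (staircase S id (Suc e))) =
    of_nat q ^ n * (transfer (of_nat q) ^^ e) (\<lambda>_. 1) n"
proof -
  let ?w = "\<lambda>k. inverse (of_nat (card (I k)) :: rat)"
  have "(\<Sum>a\<in>staircase S id (Suc e). of_nat (card (mat_ker S (Suc e) a))) / of_nat (card (staircase S id (Suc e))) =
      (\<Sum>x\<in>row_vecs S (Suc e). \<Prod>j<Suc e. ?w (min_level x j))"
    using average_kernel_size[of "Suc e" id] by simp
  also have "\<dots> = (\<Sum>x\<in>row_vecs S (Suc e). \<Prod>j<e. ?w (min_level x (Suc j)))"
    using card_layer[of n] by (simp only: prod.lessThan_Suc_shift) simp
  also have "\<dots> = (\<Sum>g\<in>row_vecs S e. \<Sum>t\<in>carrier S. \<Prod>j<e. ?w (min_level g (Suc j)))"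
    unfolding row_vecs_def sum_PiE_lessThan_Suc
    by (intro sum.cong refl prod.cong arg_cong[of _ _ ?w] min_level_cong) auto
  also have "\<dots> = of_nat (card (carrier S)) * (\<Sum>g\<in>row_vecs S e. \<Prod>j<e. ?w (min_level g (Suc j)))"
    by (simp add: sum_distrib_left)
  finally show ?thesis
    using sum_row_vecs[of e "\<lambda>_. 1"] card_layer[of 0] layer_0 by simp
qed

end

section \<open>Quotients of discrete valuation rings\<close>

text \<open>
  A discrete valuation ring with finite residue field, described by a uniformiser \<open>p\<close>; this form is convenient because
  divisibility by powers of \<open>p\<close> is all that is needed about its quotients.
\<close>

locale discrete_valuation_domain = domain R for R (structure) +
  fixes p :: 'a
  assumes p_closed: "p \<in> carrier R"
    and p_nonzero: "p \<noteq> \<zero>"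
    and p_not_unit: "p \<notin> Units R"
    and factorization: "x \<in> carrier R - {\<zero>} \<Longrightarrow> \<exists>k::nat. \<exists>u\<in>Units R. x = u \<otimes> p [^] k"
    and finite_residues: "finite (carrier (R Quot PIdl p))"
begin

abbreviation residue_size :: nat where
  "residue_size \<equiv> card (carrier (R Quot PIdl p))"

lemma mem_PIdl: "y \<in> PIdl a \<longleftrightarrow> (\<exists>x\<in>carrier R. y = x \<otimes> a)"
  by (auto simp: cgenideal_def)

lemma pow_closed: "p [^] (k::nat) \<in> carrier R"
  using p_closed by simp

lemma pow_nonzero: "p [^] (k::nat) \<noteq> \<zero>"
proof (induction k)
  case (Suc k)
  then show ?case using p_closed p_nonzero integral[of "p [^] k" p] by auto
qed simp

lemma ideal_PIdl_pow: "ideal (PIdl (p [^] (k::nat))) R"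
  by (rule cgenideal_ideal[OF pow_closed])

lemma PIdl_pow_antimono:
  fixes k m :: nat
  assumes "k \<le> m"
  shows "PIdl (p [^] m) \<subseteq> PIdl (p [^] k)"
proof
  fix y assume "y \<in> PIdl (p [^] m)"
  then obtain x where x: "x \<in> carrier R" "y = x \<otimes> p [^] m" unfolding mem_PIdl by blast
  have "p [^] m = p [^] (m - k) \<otimes> p [^] k"
    using assms p_closed by (simp add: nat_pow_mult)
  then have "y = (x \<otimes> p [^] (m - k)) \<otimes> p [^] k"
    using x pow_closed by (simp add: m_assoc)
  then show "y \<in> PIdl (p [^] k)" unfolding mem_PIdl using x pow_closed by blast
qed

text \<open>
  The product of ideals is generated under sums by the products of their elements, so for principal
  ideals one inclusion needs closure of \<open>PIdl (a \<otimes> b)\<close> under addition only.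
\<close>

lemma ideal_prod_PIdl:
  assumes "a \<in> carrier R" "b \<in> carrier R"
  shows "ideal_prod R (PIdl a) (PIdl b) = PIdl (a \<otimes> b)"
proof
  show "ideal_prod R (PIdl a) (PIdl b) \<subseteq> PIdl (a \<otimes> b)"
  proof
    fix z assume "z \<in> ideal_prod R (PIdl a) (PIdl b)"
    then show "z \<in> PIdl (a \<otimes> b)"
    proof induction
      case (prod i j)
      then obtain x y where "x \<in> carrier R" "y \<in> carrier R" "i = x \<otimes> a" "j = y \<otimes> b"
        unfolding mem_PIdl by blast
      then have "i \<otimes> j = (x \<otimes> y) \<otimes> (a \<otimes> b)" "x \<otimes> y \<in> carrier R"
        using assms by (simp_all add: m_ac)
      then show ?case unfolding mem_PIdl by blast
    next
      case (sum s t)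
      then show ?case
        using additive_subgroup.a_closed[OF ideal.axioms(1)[OF cgenideal_ideal[of "a \<otimes> b"]]] assms
        by simp
    qed
  qed
  show "PIdl (a \<otimes> b) \<subseteq> ideal_prod R (PIdl a) (PIdl b)"
  proof
    fix z assume "z \<in> PIdl (a \<otimes> b)"
    then obtain x where x: "x \<in> carrier R" "z = x \<otimes> (a \<otimes> b)" unfolding mem_PIdl by blast
    have "x \<otimes> a \<in> PIdl a" unfolding mem_PIdl using x by blast
    from ideal_prod.prod[OF this cgenideal_self[OF assms(2)], of R]
    show "z \<in> ideal_prod R (PIdl a) (PIdl b)" using x assms by (simp add: m_assoc)
  qed
qed

lemma ideal_power_PIdl: "ideal_power R (PIdl p) k = PIdl (p [^] k)"
proof (induction k)
  case 0
  have "PIdl \<one> = carrier R" unfolding cgenideal_def by force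
  then show ?case by (simp add: ideal_power_def nat_pow_def ideals_set_def)
next
  case (Suc k)
  have "ideal_power R (PIdl p) (Suc k) = ideal_prod R (ideal_power R (PIdl p) k) (PIdl p)"
    by (simp add: ideal_power_def nat_pow_def ideals_set_def)
  then show ?case using Suc ideal_prod_PIdl[OF pow_closed p_closed] by simp
qed

lemma carrier_Quot: "carrier (R Quot J) = (\<lambda>r. J +> r) ` carrier R"
  by (auto simp: FactRing_def A_RCOSETS_def')

lemma residue_size_gt_1: "1 < residue_size"
proof -
  let ?P = "PIdl p"
  have ideal: "ideal ?P R" using p_closed by (rule cgenideal_ideal)
  have "?P +> \<one> \<noteq> ?P +> \<zero>"
  proof
    assume "?P +> \<one> = ?P +> \<zero>"
    then have "\<one> \<ominus> \<zero> \<in> ?P" using quotient_eq_iff_same_a_r_cos[OF ideal] by simp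
    then obtain x where "x \<in> carrier R" "\<one> = x \<otimes> p" unfolding mem_PIdl by (auto simp: a_minus_def)
    then show False using p_not_unit p_closed m_comm unfolding Units_def by force
  qed
  then have card: "card {?P +> \<one>, ?P +> \<zero>} = 2" by simp
  have "{?P +> \<one>, ?P +> \<zero>} \<subseteq> carrier (R Quot ?P)" unfolding carrier_Quot by auto
  from card_mono[OF finite_residues this] show ?thesis unfolding card by simp
qed

text \<open>
  Downward induction on \<open>m\<close>. Every element of \<open>p\<^sup>m R\<close> modulo \<open>p\<^sup>n\<close> is, in exactly one way,
  \<open>p\<^sup>m\<close> times a chosen representative of a residue class modulo \<open>p\<close>, plus an element of
  \<open>p\<^sup>m\<^sup>+\<^sup>1 R\<close> modulo \<open>p\<^sup>n\<close>: this is the leading digit of the \<open>p\<close>-adic expansion. So each step of the chain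
  has index \<open>q\<close>.
\<close>

lemma card_image_PIdl_pow:
  assumes "m \<le> n"
  shows "card ((\<lambda>r. PIdl (p [^] n) +> r) ` (PIdl (p [^] m))) = residue_size ^ (n - m)"
  using assms
proof (induction rule: inc_induct)
  case base
  interpret J: ideal "PIdl (p [^] n)" R by (rule ideal_PIdl_pow)
  have "(\<lambda>r. PIdl (p [^] n) +> r) ` (PIdl (p [^] n)) = {PIdl (p [^] n)}"
    using J.a_rcos_const J.zero_closed by (auto intro!: image_eqI[of _ _ \<zero>])
  then show ?case by simp
next
  case (step m)
  define J where "J = PIdl (p [^] n)"
  define P where "P = PIdl p"
  define h where "h = (\<lambda>r. J +> r)"
  let ?S = "R Quot J"
  interpret J: ideal J R unfolding J_def by (rule ideal_PIdl_pow)
  interpret S: cring ?S using J.quotient_is_cring is_cring by blast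
  interpret h: ring_hom_ring R ?S h unfolding h_def by (rule J.rcos_ring_hom_ring)
  have idealP: "ideal P R" unfolding P_def using p_closed by (rule cgenideal_ideal)
  have h_eq: "h a = h b \<longleftrightarrow> a \<ominus> b \<in> J" if "a \<in> carrier R" "b \<in> carrier R" for a b
    unfolding h_def using quotient_eq_iff_same_a_r_cos[OF J.is_ideal that] by simp
  have J_sub: "J \<subseteq> PIdl (p [^] Suc m)"
    unfolding J_def using step by (intro PIdl_pow_antimono) simp
  \<comment> \<open>The admissible digits: one representative for each residue class modulo \<open>p\<close>.\<close>
  define rep where "rep C = (SOME r. r \<in> carrier R \<and> P +> r = C)" for C
  have rep: "rep C \<in> carrier R" "P +> rep C = C" if "C \<in> carrier (R Quot P)" for C
  proof -
    have "\<exists>r. r \<in> carrier R \<and> P +> r = C" using that unfolding carrier_Quot by auto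
    then have "rep C \<in> carrier R \<and> P +> rep C = C" unfolding rep_def by (rule someI_ex)
    then show "rep C \<in> carrier R" "P +> rep C = C" by auto
  qed
  define f where "f = (\<lambda>(C, y). h (rep C \<otimes> p [^] m) \<oplus>\<^bsub>?S\<^esub> y)"
  let ?A = "carrier (R Quot P)" and ?B = "h ` (PIdl (p [^] Suc m))"
  have split_pow: "w \<otimes> p [^] Suc m = (w \<otimes> p) \<otimes> p [^] m" if "w \<in> carrier R" for w
    using that p_closed by (simp add: m_ac)
  have "inj_on f (?A \<times> ?B)"
  proof (rule inj_onI, clarsimp)
    fix C D y z
    assume CD: "C \<in> ?A" "D \<in> ?A" and y: "y \<in> PIdl (p [^] m \<otimes> p)" and z: "z \<in> PIdl (p [^] m \<otimes> p)"
      and eq: "f (C, h y) = f (D, h z)"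
    interpret Q: ideal "PIdl (p [^] m \<otimes> p)" R using ideal_PIdl_pow[of "Suc m"] by simp
    have yz: "y \<in> carrier R" "z \<in> carrier R" using y z Q.Icarr by auto
    note c = rep(1)[OF CD(1)] rep(1)[OF CD(2)] pow_closed p_closed yz
    have "h (rep C \<otimes> p [^] m \<oplus> y) = h (rep D \<otimes> p [^] m \<oplus> z)"
      using eq c by (simp add: f_def)
    then have "(rep C \<otimes> p [^] m \<oplus> y) \<ominus> (rep D \<otimes> p [^] m \<oplus> z) \<in> J"
      using h_eq[of "rep C \<otimes> p [^] m \<oplus> y" "rep D \<otimes> p [^] m \<oplus> z"] c
      by (simp del: h.hom_add h.hom_mult)
    then have "(rep C \<otimes> p [^] m \<oplus> y) \<ominus> (rep D \<otimes> p [^] m \<oplus> z) \<in> PIdl (p [^] m \<otimes> p)"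
      using J_sub by auto
    \<comment> \<open>Modulo \<open>p\<^sup>m\<^sup>+\<^sup>1\<close> the summands \<open>y\<close> and \<open>z\<close> vanish, so only the leading digits are compared.\<close>
    then have "((rep C \<otimes> p [^] m \<oplus> y) \<ominus> (rep D \<otimes> p [^] m \<oplus> z)) \<oplus> (z \<ominus> y) \<in> PIdl (p [^] m \<otimes> p)"
      using y z Q.a_closed Q.a_inv_closed by (simp add: a_minus_def)
    moreover have "((rep C \<otimes> p [^] m \<oplus> y) \<ominus> (rep D \<otimes> p [^] m \<oplus> z)) \<oplus> (z \<ominus> y) =
        (rep C \<ominus> rep D) \<otimes> p [^] m"
      using c by algebra
    ultimately obtain w where w: "w \<in> carrier R"
      "(rep C \<ominus> rep D) \<otimes> p [^] m = w \<otimes> (p [^] m \<otimes> p)"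
      unfolding mem_PIdl by auto
    then have "(rep C \<ominus> rep D) \<otimes> p [^] m = (w \<otimes> p) \<otimes> p [^] m"
      using split_pow by simp
    then have "rep C \<ominus> rep D = w \<otimes> p"
      using m_rcancel[OF pow_nonzero pow_closed] c w(1) by simp
    then have "rep C \<ominus> rep D \<in> P" unfolding P_def mem_PIdl using w(1) by blast
    then have CD_eq: "C = D"
      using quotient_eq_iff_same_a_r_cos[OF idealP c(1) c(2)] rep(2) CD by metis
    have hc: "h y \<in> carrier ?S" "h z \<in> carrier ?S" "h (rep D \<otimes> p [^] m) \<in> carrier ?S"
      using c by (simp_all del: h.hom_mult)
    from eq have "h (rep D \<otimes> p [^] m) \<oplus>\<^bsub>?S\<^esub> h y = h (rep D \<otimes> p [^] m) \<oplus>\<^bsub>?S\<^esub> h z"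
      unfolding f_def CD_eq by (simp only: prod.case)
    then have "h y = h z"
      using hc S.a_comm[OF hc(3,1)] S.a_comm[OF hc(3,2)] by (simp only: S.add.right_cancel)
    with CD_eq show "C = D \<and> h y = h z" by simp
  qed
  moreover have "f ` (?A \<times> ?B) = h ` (PIdl (p [^] m))"
  proof
    show "f ` (?A \<times> ?B) \<subseteq> h ` (PIdl (p [^] m))"
    proof clarsimp
      fix C y assume C: "C \<in> ?A" and "y \<in> PIdl (p [^] m \<otimes> p)"
      then obtain w where w: "w \<in> carrier R" "y = w \<otimes> p [^] Suc m" unfolding mem_PIdl by auto
      have "f (C, h y) = h ((rep C \<oplus> w \<otimes> p) \<otimes> p [^] m)"
        unfolding f_def w(2) split_pow[OF w(1)]
        using rep(1)[OF C] w(1) p_closed pow_closed by (simp add: l_distr)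
      moreover have "(rep C \<oplus> w \<otimes> p) \<otimes> p [^] m \<in> PIdl (p [^] m)"
        unfolding mem_PIdl using rep(1)[OF C] w(1) p_closed by blast
      ultimately show "f (C, h y) \<in> h ` (PIdl (p [^] m))" by simp
    qed
    show "h ` (PIdl (p [^] m)) \<subseteq> f ` (?A \<times> ?B)"
    proof clarify
      fix y assume "y \<in> PIdl (p [^] m)"
      then obtain r where r: "r \<in> carrier R" "y = r \<otimes> p [^] m" unfolding mem_PIdl by auto
      have C: "P +> r \<in> ?A" unfolding carrier_Quot using r(1) by blast
      have "r \<ominus> rep (P +> r) \<in> P"
        using quotient_eq_iff_same_a_r_cos[OF idealP r(1) rep(1)[OF C]] rep(2)[OF C] by simp
      then obtain w where w: "w \<in> carrier R" "r \<ominus> rep (P +> r) = w \<otimes> p"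
        unfolding P_def mem_PIdl by auto
      have "r = rep (P +> r) \<oplus> (r \<ominus> rep (P +> r))" using r(1) rep(1)[OF C] by algebra
      then have "r = rep (P +> r) \<oplus> w \<otimes> p" unfolding w(2) .
      then have "y = (rep (P +> r) \<oplus> w \<otimes> p) \<otimes> p [^] m" unfolding r(2) by simp
      also have "\<dots> = rep (P +> r) \<otimes> p [^] m \<oplus> w \<otimes> p [^] Suc m"
        unfolding split_pow[OF w(1)] using rep(1)[OF C] w(1) p_closed pow_closed by (simp add: l_distr)
      finally have "h y = f (P +> r, h (w \<otimes> p [^] Suc m))"
        unfolding f_def using rep(1)[OF C] w(1) p_closed pow_closed by simp
      moreover have "w \<otimes> p [^] Suc m \<in> PIdl (p [^] Suc m)"
        unfolding mem_PIdl using w(1) by blast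
      ultimately show "h y \<in> f ` (?A \<times> ?B)" using C by blast
    qed
  qed
  ultimately have "card (h ` (PIdl (p [^] m))) = card (?A \<times> ?B)"
    by (metis card_image)
  also have "\<dots> = residue_size * residue_size ^ (n - Suc m)"
    using step by (simp add: card_cartesian_product P_def h_def J_def)
  also have "\<dots> = residue_size ^ (n - m)"
    using step by (simp add: Suc_diff_Suc flip: power_Suc)
  finally show ?case by (simp add: h_def J_def)
qed

text \<open>
  A unit multiple \<open>u p\<^sup>k\<close> generates the same ideal as \<open>p\<^sup>k\<close>, so each principal ideal of the quotient
  is one of the images of \<open>p\<^sup>k R\<close>.
\<close>

lemma finite_chain_ring_quot_level:
  "finite_chain_ring (quot_level R (PIdl p) n)
     (\<lambda>m. (\<lambda>r. PIdl (p [^] n) +> r) ` (PIdl (p [^] m))) n residue_size"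
proof -
  define J where "J = PIdl (p [^] n)"
  define h where "h = (\<lambda>r. J +> r)"
  let ?S = "R Quot J"
  interpret J: ideal J R unfolding J_def by (rule ideal_PIdl_pow)
  interpret S: cring ?S using J.quotient_is_cring is_cring by blast
  interpret h: ring_hom_ring R ?S h unfolding h_def by (rule J.rcos_ring_hom_ring)
  have surj: "carrier ?S = h ` carrier R" unfolding h_def by (rule carrier_Quot)
  have zero: "h a = \<zero>\<^bsub>?S\<^esub>" if "a \<in> J" for a
    using J.a_rcos_const[OF that] by (simp add: h_def FactRing_def)
  have "finite_chain_ring ?S (\<lambda>m. h ` (PIdl (p [^] m))) n residue_size"
  proof (intro finite_chain_ring.intro finite_chain_ring_axioms.intro)
    show "cring ?S" by (rule S.is_cring)
  next
    fix m :: nat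
    show "ideal (h ` (PIdl (p [^] m))) ?S"
      unfolding h_def using J.is_ideal ideal_PIdl_pow by (rule ring_ideal_imp_quot_ideal)
    show "h ` (PIdl (p [^] Suc m)) \<subseteq> h ` (PIdl (p [^] m))"
      by (intro image_mono PIdl_pow_antimono) simp
    show "card (h ` (PIdl (p [^] m))) = residue_size ^ (n - m)" if "m \<le> n"
      unfolding h_def J_def using that by (rule card_image_PIdl_pow)
  next
    have "PIdl \<one> = carrier R" unfolding cgenideal_def by force
    then show "h ` (PIdl (p [^] (0::nat))) = carrier ?S" using surj by simp
  next
    show "1 < residue_size" by (rule residue_size_gt_1)
  next
    fix x assume "x \<in> carrier ?S"
    then obtain r where r: "r \<in> carrier R" "x = h r" unfolding surj by blast
    show "\<exists>m\<le>n. (\<lambda>y. x \<otimes>\<^bsub>?S\<^esub> y) ` carrier ?S = h ` (PIdl (p [^] m))"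
    proof (cases "r \<in> J")
      case True
      have "(\<lambda>y. x \<otimes>\<^bsub>?S\<^esub> y) ` carrier ?S = {\<zero>\<^bsub>?S\<^esub>}"
        unfolding r(2) zero[OF True] using S.zero_closed by force
      also have "\<dots> = h ` (PIdl (p [^] n))"
        using zero J.zero_closed unfolding J_def by force
      finally show ?thesis by blast
    next
      case False
      then have "r \<noteq> \<zero>" using J.zero_closed by blast
      then obtain k u where u: "u \<in> Units R" "r = u \<otimes> p [^] (k::nat)"
        using factorization[of r] r(1) by auto
      then have uc: "u \<in> carrier R" "inv u \<in> carrier R" "inv u \<otimes> u = \<one>"
        by auto
      have "k \<le> n"
      proof (rule ccontr)
        assume "\<not> k \<le> n"
        then have "PIdl (p [^] k) \<subseteq> J" unfolding J_def by (intro PIdl_pow_antimono) simp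
        then show False using False u(2) uc(1) unfolding mem_PIdl[of r] subset_iff mem_PIdl by blast
      qed
      moreover have "(\<lambda>y. x \<otimes>\<^bsub>?S\<^esub> y) ` carrier ?S = h ` (PIdl (p [^] k))"
      proof -
        have "(\<lambda>s. r \<otimes> s) ` carrier R = PIdl (p [^] k)"
        proof
          show "(\<lambda>s. r \<otimes> s) ` carrier R \<subseteq> PIdl (p [^] k)"
          proof clarify
            fix s assume "s \<in> carrier R"
            then have "r \<otimes> s = (u \<otimes> s) \<otimes> p [^] k" "u \<otimes> s \<in> carrier R"
              using u(2) uc pow_closed by (simp_all add: m_ac)
            then show "r \<otimes> s \<in> PIdl (p [^] k)" unfolding mem_PIdl by blast
          qed
          show "PIdl (p [^] k) \<subseteq> (\<lambda>s. r \<otimes> s) ` carrier R"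
          proof
            fix y assume "y \<in> PIdl (p [^] k)"
            then obtain w where w: "w \<in> carrier R" "y = w \<otimes> p [^] k" unfolding mem_PIdl by blast
            have "r \<otimes> (inv u \<otimes> w) = (inv u \<otimes> u) \<otimes> (w \<otimes> p [^] k)"
              unfolding u(2) using uc(1,2) w(1) pow_closed by (simp add: m_ac)
            then have "y = r \<otimes> (inv u \<otimes> w)"
              using uc w pow_closed by simp
            then show "y \<in> (\<lambda>s. r \<otimes> s) ` carrier R" using uc(2) w(1) by blast
          qed
        qed
        moreover have "(\<lambda>y. x \<otimes>\<^bsub>?S\<^esub> y) ` carrier ?S = h ` (\<lambda>s. r \<otimes> s) ` carrier R"
          unfolding surj image_image r(2) using r(1) by (intro image_cong) auto
        ultimately show ?thesis by simp
      qed
      ultimately show ?thesis by blast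
    qed
  qed
  then show ?thesis unfolding quot_level_def ideal_power_PIdl h_def J_def .
qed

text \<open>
  Entrywise lifting shows that reduction is onto, provided that zero entries are lifted to zero.
\<close>

lemma reduce_staircase:
  "reduce_mat R (PIdl p) d n ` staircase R c d = staircase (quot_level R (PIdl p) n) c d"
proof -
  define J where "J = PIdl (p [^] n)"
  let ?S = "R Quot J" and ?D = "{..<d} \<times> {..<d}"
  interpret J: ideal J R unfolding J_def by (rule ideal_PIdl_pow)
  have zero: "J +> \<zero> = \<zero>\<^bsub>?S\<^esub>"
    using J.a_rcos_const[OF J.zero_closed] by (simp add: FactRing_def)
  have "(\<lambda>a. \<lambda>ij\<in>?D. J +> a ij) ` staircase R c d = staircase ?S c d"
  proof
    show "(\<lambda>a. \<lambda>ij\<in>?D. J +> a ij) ` staircase R c d \<subseteq> staircase ?S c d"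
      unfolding staircase_def mats_def carrier_Quot using zero by (auto simp: PiE_iff)
    show "staircase ?S c d \<subseteq> (\<lambda>a. \<lambda>ij\<in>?D. J +> a ij) ` staircase R c d"
    proof
      fix b assume b: "b \<in> staircase ?S c d"
      have "\<exists>r. r \<in> carrier R \<and> J +> r = C \<and> (C = \<zero>\<^bsub>?S\<^esub> \<longrightarrow> r = \<zero>)" if "C \<in> carrier ?S" for C
        using that zero unfolding carrier_Quot by (cases "C = \<zero>\<^bsub>?S\<^esub>") auto
      then obtain rep where rep: "\<And>C. C \<in> carrier ?S \<Longrightarrow>
          rep C \<in> carrier R \<and> J +> rep C = C \<and> (C = \<zero>\<^bsub>?S\<^esub> \<longrightarrow> rep C = \<zero>)" by metis
      have bc: "b ij \<in> carrier ?S" if "ij \<in> ?D" for ij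
        using b that unfolding staircase_def mats_def by blast
      define a where "a = (\<lambda>ij\<in>?D. rep (b ij))"
      have "a \<in> mats R d" unfolding mats_def a_def using rep bc by simp
      moreover have "a (i, j) = \<zero>" if "i < d" "j < d" "c j \<le> i" for i j
      proof -
        have "b (i, j) = \<zero>\<^bsub>?S\<^esub>" using b that unfolding staircase_def by blast
        then show ?thesis using rep[OF bc[of "(i, j)"]] that by (simp add: a_def)
      qed
      ultimately have "a \<in> staircase R c d" unfolding staircase_def by blast
      moreover have "b = (\<lambda>ij\<in>?D. J +> a ij)"
      proof
        fix ij
        show "b ij = (\<lambda>ij\<in>?D. J +> a ij) ij"
        proof (cases "ij \<in> ?D")
          case True
          then show ?thesis using rep[OF bc[OF True]] by (simp add: a_def)
        next
          case False
          have "b \<in> ?D \<rightarrow>\<^sub>E carrier ?S" using b unfolding staircase_def mats_def by blast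
          then have "b ij = undefined" using False by (rule PiE_arb)
          then show ?thesis using False by (simp only: restrict_apply if_False)
        qed
      qed
      ultimately show "b \<in> (\<lambda>a. \<lambda>ij\<in>?D. J +> a ij) ` staircase R c d" by blast
    qed
  qed
  then show ?thesis
    by (simp add: reduce_mat_def[abs_def] ideal_power_PIdl quot_level_def J_def)
qed

lemma ask_average_upper_tri:
  "ask_average R (PIdl p) d (upper_tri_mats R d) n =
    (transfer (of_nat residue_size) ^^ d) (\<lambda>_. 1) n"
  using finite_chain_ring.average_kernel_triangular[OF finite_chain_ring_quot_level]
  by (simp add: ask_average_def upper_tri_mats_eq_staircase reduce_staircase)

lemma ask_average_strict_upper_tri:
  "ask_average R (PIdl p) (Suc e) (strict_upper_tri_mats R (Suc e)) n =
    of_nat residue_size ^ n * (transfer (of_nat residue_size) ^^ e) (\<lambda>_. 1) n"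
  using finite_chain_ring.average_kernel_strictly_triangular[OF finite_chain_ring_quot_level]
  by (simp add: ask_average_def strict_upper_tri_mats_eq_staircase reduce_staircase)

end

section \<open>Valuation rings\<close>

context discretely_valued_field
begin

lemma v_one: "v \<one> = 0"
  using v_mult[of \<one> \<one>] by simp

lemma v_inv:
  assumes "x \<in> carrier K - {\<zero>}"
  shows "inv x \<in> carrier K - {\<zero>}" "v (inv x) = - v x"
proof -
  have x: "x \<in> Units K" using assms by (simp add: field_Units)
  then show i: "inv x \<in> carrier K - {\<zero>}" using Units_inv_Units field_Units by blast
  show "v (inv x) = - v x" using v_mult[OF assms i] v_one x by simp
qed

text \<open>
  As \<open>(-1)(-1) = 1\<close>, twice the valuation of \<open>-1\<close> vanishes.
\<close>

lemma v_uminus: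
  assumes "x \<in> carrier K - {\<zero>}"
  shows "v (\<ominus> x) = v x"
proof -
  have m: "\<ominus> \<one> \<in> carrier K - {\<zero>}" using add.inv_eq_1_iff[of \<one>] by simp
  have "\<ominus> \<one> \<otimes> \<ominus> \<one> = \<one>" by (simp add: l_minus)
  then have "v (\<ominus> \<one>) = 0" using v_mult[OF m m] v_one by simp
  moreover have "\<ominus> \<one> \<otimes> x = \<ominus> x" using assms by (simp add: l_minus)
  ultimately show ?thesis using v_mult[OF m assms] by simp
qed

lemma subring_valuation: "subring {x \<in> carrier K. x = \<zero> \<or> 0 \<le> v x} K"
proof (rule subringI)
  fix x y
  assume xy: "x \<in> {x \<in> carrier K. x = \<zero> \<or> 0 \<le> v x}" "y \<in> {x \<in> carrier K. x = \<zero> \<or> 0 \<le> v x}"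
  show "x \<otimes> y \<in> {x \<in> carrier K. x = \<zero> \<or> 0 \<le> v x}"
    using xy v_mult[of x y] by (cases "x = \<zero> \<or> y = \<zero>") auto
  show "x \<oplus> y \<in> {x \<in> carrier K. x = \<zero> \<or> 0 \<le> v x}"
    using xy v_add[of x y] by (cases "x = \<zero> \<or> y = \<zero>") auto
  show "\<ominus> x \<in> {x \<in> carrier K. x = \<zero> \<or> 0 \<le> v x}"
    using xy v_uminus[of x] by (cases "x = \<zero>") auto
qed (use v_one in auto)

lemma divide_valuation:
  assumes "x \<in> carrier K - {\<zero>}" "y \<in> carrier K - {\<zero>}"
  obtains z where "z \<in> carrier K - {\<zero>}" "x = z \<otimes> y" "v z = v x - v y"
proof
  note i = v_inv[OF assms(2)]
  have y: "inv y \<otimes> y = \<one>" using assms(2) by (simp add: field_Units)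
  show "x \<otimes> inv y \<in> carrier K - {\<zero>}" using assms i integral[of x "inv y"] by auto
  show "x = (x \<otimes> inv y) \<otimes> y" using assms i y by (simp add: m_assoc)
  show "v (x \<otimes> inv y) = v x - v y" using v_mult[OF assms(1) i(1)] i(2) by simp
qed

end

text \<open>
  Any element of valuation \<open>1\<close> serves as uniformiser: an element of valuation \<open>k \<ge> 0\<close> is its
  \<open>k\<close>-th power times an element of valuation \<open>0\<close>, and the latter are the units.
\<close>

lemma (in nonarch_local_field) discrete_valuation_domain_valuation_ring:
  "\<exists>p. discrete_valuation_domain (valuation_ring K v) p \<and>
       PIdl\<^bsub>valuation_ring K v\<^esub> p = valuation_ideal K v"
proof -
  let ?R = "valuation_ring K v" and ?H = "{x \<in> carrier K. x = \<zero> \<or> 0 \<le> v x}"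
  have R_simps: "carrier ?R = ?H" "monoid.mult ?R = monoid.mult K" "\<one>\<^bsub>?R\<^esub> = \<one>" "\<zero>\<^bsub>?R\<^esub> = \<zero>"
    by (simp_all add: valuation_ring_def)
  have "domain ?R"
    unfolding valuation_ring_def using subring_valuation subdomainI' subdomain_is_domain by blast
  then interpret R: domain ?R .
  obtain p where p: "p \<in> carrier K - {\<zero>}" "v p = 1" using v_surj by (metis UNIV_I imageE)
  have pR: "p \<in> carrier ?R" using p by (simp add: R_simps)
  have pow: "p [^]\<^bsub>?R\<^esub> k \<in> carrier K - {\<zero>} \<and> v (p [^]\<^bsub>?R\<^esub> k) = int k" for k :: nat
  proof (induction k)
    case 0
    then show ?case using v_one by (simp add: R_simps)
  next
    case (Suc k)
    then show ?case using p v_mult[of "p [^]\<^bsub>?R\<^esub> k" p] integral[of "p [^]\<^bsub>?R\<^esub> k" p]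
      by (auto simp: R_simps)
  qed
  have PIdl: "PIdl\<^bsub>?R\<^esub> p = valuation_ideal K v"
  proof
    show "PIdl\<^bsub>?R\<^esub> p \<subseteq> valuation_ideal K v"
    proof
      fix y assume "y \<in> PIdl\<^bsub>?R\<^esub> p"
      then obtain x where "x \<in> ?H" "y = x \<otimes> p" by (auto simp: cgenideal_def R_simps)
      then show "y \<in> valuation_ideal K v"
        using p v_mult[of x p] by (cases "x = \<zero>") (auto simp: valuation_ideal_def)
    qed
    show "valuation_ideal K v \<subseteq> PIdl\<^bsub>?R\<^esub> p"
    proof
      fix y assume y: "y \<in> valuation_ideal K v"
      show "y \<in> PIdl\<^bsub>?R\<^esub> p"
      proof (cases "y = \<zero>")
        case True
        then have "y = \<zero> \<otimes> p" "\<zero> \<in> ?H" using p by auto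
        then show ?thesis unfolding cgenideal_def R_simps by blast
      next
        case False
        then have y': "y \<in> carrier K - {\<zero>}" "0 < v y" using y by (auto simp: valuation_ideal_def)
        from divide_valuation[OF y'(1) p(1)] obtain z
          where "z \<in> carrier K - {\<zero>}" "y = z \<otimes> p" "v z = v y - v p" by blast
        then have "z \<in> ?H" "y = z \<otimes> p" using y' p by auto
        then show ?thesis unfolding cgenideal_def R_simps by blast
      qed
    qed
  qed
  have "discrete_valuation_domain ?R p"
  proof
    show "p \<in> carrier ?R" by (rule pR)
    show "p \<noteq> \<zero>\<^bsub>?R\<^esub>" using p by (simp add: R_simps)
    show "p \<notin> Units ?R"
    proof
      assume "p \<in> Units ?R"
      then obtain y where y: "y \<in> ?H" "y \<otimes> p = \<one>" unfolding Units_def R_simps by blast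
      then have "y \<noteq> \<zero>" using p one_not_zero by auto
      then show False using y v_mult[of y p] p v_one by auto
    qed
    show "finite (carrier (?R Quot PIdl\<^bsub>?R\<^esub> p))"
      unfolding PIdl using finite_residue_field by (simp add: residue_field_def)
    fix x assume "x \<in> carrier ?R - {\<zero>\<^bsub>?R\<^esub>}"
    then have x: "x \<in> carrier K - {\<zero>}" "0 \<le> v x" by (auto simp: R_simps)
    let ?k = "nat (v x)"
    from divide_valuation[OF x(1), of "p [^]\<^bsub>?R\<^esub> ?k"] pow[of ?k] obtain u
      where u: "u \<in> carrier K - {\<zero>}" "x = u \<otimes> p [^]\<^bsub>?R\<^esub> ?k" "v u = v x - v (p [^]\<^bsub>?R\<^esub> ?k)" by blast
    have "v u = 0" using u(3) pow[of ?k] x(2) by simp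
    then have "inv u \<in> ?H" "u \<in> ?H" using v_inv[OF u(1)] u(1) by auto
    moreover have "inv u \<otimes> u = \<one>" "u \<otimes> inv u = \<one>" using u(1) by (simp_all add: field_Units)
    ultimately have "u \<in> Units ?R" unfolding Units_def R_simps by blast
    then show "\<exists>k::nat. \<exists>u\<in>Units ?R. x = u \<otimes>\<^bsub>?R\<^esub> p [^]\<^bsub>?R\<^esub> k" using u(2) R_simps(2) by metis
  qed
  with PIdl show ?thesis by blast
qed

section \<open>The ask zeta functions of triangular matrices\<close>

theorem proposition5p15:
  fixes K :: "('a, 'b) ring_scheme" and v :: "'a \<Rightarrow> int" and d :: nat
  assumes "nonarch_local_field K v" and "d \<ge> 1"
  shows
    "let R = valuation_ring K v;
         P = valuation_ideal K v;
         q = (of_nat (card (carrier (residue_field K v))) :: rat);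
         T = (fps_X :: rat fps);
         Z_n = (\<lambda>e. ask_zeta R P e (strict_upper_tri_mats R e));
         Z_tr = (\<lambda>e. ask_zeta R P e (upper_tri_mats R e))
     in
       Z_n d = (1 - T) ^ (d - 1) / (1 - fps_const q * T) ^ d
     \<and> Z_tr d = fps_compose (Z_n (d + 1)) (fps_const (inverse q) * T)
     \<and> Z_tr d = (1 - fps_const (inverse q) * T) ^ d / (1 - T) ^ (d + 1)"
proof -
  define R where "R = valuation_ring K v"
  define P where "P = valuation_ideal K v"
  define q where "q = (of_nat (card (carrier (residue_field K v))) :: rat)"
  \<comment> \<open>The generating function of the triangular averages; the strictly triangular ones of size
    \<open>e + 1\<close> are obtained from it by the substitution of \<open>qT\<close> for \<open>T\<close>.\<close>
  define G where "G e = Abs_fps ((transfer q ^^ e) (\<lambda>_. 1))" for e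
  obtain p where "discrete_valuation_domain R p" and PIdl: "PIdl\<^bsub>R\<^esub> p = P"
    unfolding R_def P_def
    using nonarch_local_field.discrete_valuation_domain_valuation_ring[OF assms(1)] by blast
  then interpret R: discrete_valuation_domain R p by simp
  have q: "q = of_nat R.residue_size"
    by (simp add: q_def residue_field_def PIdl flip: R_def P_def)
  have q0: "q \<noteq> 0" using R.residue_size_gt_1 unfolding q by simp
  have Z_tr: "ask_zeta R P e (upper_tri_mats R e) = G e" for e
    using R.ask_average_upper_tri[of e] unfolding PIdl G_def ask_zeta_def q by (simp add: fps_eq_iff)
  have Z_n: "ask_zeta R P (Suc e) (strict_upper_tri_mats R (Suc e)) =
      fps_compose (G e) (fps_const q * fps_X)" for e
    using R.ask_average_strict_upper_tri[of e]
    unfolding PIdl ask_zeta_def fps_compose_linear q G_def by (simp add: fps_eq_iff)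
  have G: "G e = (1 - fps_const (inverse q) * fps_X) ^ e / (1 - fps_X) ^ (e + 1)" for e
    unfolding G_def by (rule fps_transfer_iterate)
  obtain e where e: "d = Suc e" using assms(2) by (cases d) auto
  have c0: "fps_nth (fps_const q * fps_X) 0 = 0" by simp
  have c1: "fps_compose (1 - fps_const (inverse q) * fps_X) (fps_const q * fps_X) = 1 - fps_X"
    unfolding fps_compose_linear using q0 by (auto simp: fps_eq_iff le_Suc_eq)
  have c2: "fps_compose (1 - fps_X) (fps_const q * fps_X) = 1 - fps_const q * fps_X"
    unfolding fps_compose_linear by (auto simp: fps_eq_iff le_Suc_eq)
  have "fps_compose (G e) (fps_const q * fps_X) = (1 - fps_X) ^ e / (1 - fps_const q * fps_X) ^ (e + 1)"
  proof -
    have "fps_const q * fps_X \<noteq> 1" using c0 by (metis fps_one_nth zero_neq_one)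
    moreover have "fps_nth ((1 - fps_X :: rat fps) ^ (e + 1)) 0 \<noteq> 0"
      by (simp add: fps_power_zeroth)
    ultimately show ?thesis
      unfolding G
      by (subst fps_compose_divide_distrib)
         (auto simp: fps_compose_power[OF c0, symmetric] c1 c2 fps_unit_dvd simp del: power_Suc)
  qed
  then have 1: "ask_zeta R P d (strict_upper_tri_mats R d) =
      (1 - fps_X) ^ (d - 1) / (1 - fps_const q * fps_X) ^ d"
    using Z_n[of e] unfolding e by simp
  have 2: "ask_zeta R P d (upper_tri_mats R d) =
      fps_compose (ask_zeta R P (d + 1) (strict_upper_tri_mats R (d + 1))) (fps_const (inverse q) * fps_X)"
    unfolding Z_tr using Z_n[of d] q0
    by (simp add: fps_compose_linear fps_eq_iff flip: power_mult_distrib)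
  show ?thesis
    using 1 2 Z_tr[of d] G[of d]
    unfolding Let_def R_def[symmetric] P_def[symmetric] q_def[symmetric] by simp
qed

end
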